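(* Let $(X,d)$ be a compact metric space, let $f_n:X\to X$ be continuous for every $n\ge0$, let $A=(a_{ij})_{N\times N}$ be a transition matrix, and let $\{V_{i,n}\}_{n=0}^\infty$, $1\le i\le N$, be sequences of nonempty closed subsets of $X$. Then the system $x_{n+1}=f_n(x_n)$ on $X$ is weakly $A$-coupled-expanding in $\{V_{i,n}\}_{n=0}^\infty$, $1\le i\le N$, if and only if the induced set-valued system $A_{n+1}=\bar f_n(A_n)$ on $\mathcal K(X)$ is weakly $A$-coupled-expanding in $\{\langle V_{i,n}\rangle\}_{n=0}^\infty$, $1\le i\le N$. Likewise, the system $x_{n+1}=f_n(x_n)$ is strictly weakly $A$-coupled-expanding in $\{V_{i,n}\}_{n=0}^\infty$, $1\le i\le N$, if and only if the system $A_{n+1}=\bar f_n(A_n)$ is strictly weakly $A$-coupled-expanding in $\{\langle V_{i,n}\rangle\}_{n=0}^\infty$, $1\le i\le N$.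
   Context: $\mathcal K(X)$ is the set of all nonempty compact subsets of $X$ with the Hausdorff metric $\mathcal H_d(B,C):=\max\{\sup_{b\in B}d(b,C),\sup_{c\in C}d(c,B)\}$. For nonempty $K\subset X$, $\langle K\rangle:=\{B\in\mathcal K(X):B\subset K\}$; $\bar f_n:\mathcal K(X)\to\mathcal K(X)$ is $\bar f_n(B):=f_n(B)$, and $A_{n+1}=\bar f_n(A_n)$, $n\ge0$, is the induced set-valued system. A transition matrix is a matrix $A=(a_{ij})_{N\times N}$, $N\ge2$, with $a_{ij}\in\{0,1\}$, $\sum_{j=1}^N a_{ij}\ge1$ for all $i$ and $\sum_{i=1}^N a_{ij}\ge1$ for all $j$. For a metric space $(Z,e)$ and maps $g_n:Z\to Z$, $n\ge0$, the system $z_{n+1}=g_n(z_n)$ is weakly $A$-coupled-expanding in sequences $\{W_{i,n}\}_{n=0}^\infty$, $1\le i\le N$, of nonempty subsets of $Z$ if $W_{i,n}\cap W_{j,n}=\partial W_{i,n}\cap\partial W_{j,n}$ (boundaries in $Z$) for all $1\le i\ne j\le N$, $n\ge0$, and $g_n(W_{i,n})\supset\bigcup_{j:\,a_{ij}=1}W_{j,n+1}$ for all $1\le i\le N$, $n\ge0$. It is strictly weakly $A$-coupled-expanding if the boundary condition is replaced by $e(W_{i,n},W_{j,n})>0$ for all $1\le i\ne j\le N$, $n\ge0$, where $e(B,C):=\inf\{e(b,c):b\in B,c\in C\}$. *)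

theory Defs
  imports "HOL-Analysis.Analysis"
begin

typedef (overloaded) ('a::metric_space) compacts = "{B :: 'a set. compact B \<and> B \<noteq> {}}"
  morphisms set_of_compacts Compacts
  by (rule exI[of _ "{undefined}"]) simp

lemma compact_set_of_compacts: "compact (set_of_compacts B)"
  and set_of_compacts_nonempty: "set_of_compacts B \<noteq> {}"
  using set_of_compacts[of B] by auto

definition hausdorff_dist :: "'a::metric_space set \<Rightarrow> 'a set \<Rightarrow> real" where
  "hausdorff_dist B C = max (SUP b\<in>B. infdist b C) (SUP c\<in>C. infdist c B)"

lemma bdd_above_infdist_image:
  assumes "compact B"
  shows "bdd_above ((\<lambda>b. infdist b C) ` B)"
  by (intro bounded_imp_bdd_above compact_imp_bounded compact_continuous_image
      continuous_intros assms)

lemma hausdorff_dist_le_iff: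
  assumes "compact B" "B \<noteq> {}" "compact C" "C \<noteq> {}"
  shows "hausdorff_dist B C \<le> r \<longleftrightarrow> (\<forall>b\<in>B. infdist b C \<le> r) \<and> (\<forall>c\<in>C. infdist c B \<le> r)"
  using assms by (simp add: hausdorff_dist_def cSUP_le_iff bdd_above_infdist_image)

lemma infdist_le_infdist_add:
  assumes "B \<noteq> {}" and C: "\<forall>b\<in>B. infdist b C \<le> r"
  shows "infdist a C \<le> infdist a B + r"
proof -
  have "infdist a C - r \<le> dist a b" if "b \<in> B" for b
    using infdist_triangle[of a C b] C that by fastforce
  then have "infdist a C - r \<le> infdist a B"
    using assms(1) by (simp add: infdist_notempty cINF_greatest)
  then show ?thesis by simp
qed

instantiation compacts :: (metric_space) metric_space
begin

definition dist_compacts :: "'a compacts \<Rightarrow> 'a compacts \<Rightarrow> real" where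
  "dist_compacts B C = hausdorff_dist (set_of_compacts B) (set_of_compacts C)"

definition uniformity_compacts :: "('a compacts \<times> 'a compacts) filter" where
  "uniformity_compacts = (INF e\<in>{0 <..}. principal {(B, C). dist B C < e})"

definition open_compacts :: "'a compacts set \<Rightarrow> bool" where
  "open_compacts U \<longleftrightarrow> (\<forall>B\<in>U. \<forall>\<^sub>F (B', C) in uniformity. B' = B \<longrightarrow> C \<in> U)"

instance
proof
  have le: "dist B C \<le> r \<longleftrightarrow>
      (\<forall>b\<in>set_of_compacts B. infdist b (set_of_compacts C) \<le> r) \<and>
      (\<forall>c\<in>set_of_compacts C. infdist c (set_of_compacts B) \<le> r)" for B C :: "'a compacts" and r
    unfolding dist_compacts_def
    by (intro hausdorff_dist_le_iff compact_set_of_compacts set_of_compacts_nonempty)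
  show "dist B C = 0 \<longleftrightarrow> B = C" for B C :: "'a compacts"
  proof
    assume "dist B C = 0"
    then have "\<forall>b\<in>set_of_compacts B. infdist b (set_of_compacts C) \<le> 0"
      and "\<forall>c\<in>set_of_compacts C. infdist c (set_of_compacts B) \<le> 0"
      using le[of B C 0] by auto
    then have "set_of_compacts B = set_of_compacts C"
      using in_closed_iff_infdist_zero[OF compact_imp_closed[OF compact_set_of_compacts]
          set_of_compacts_nonempty] infdist_nonneg
      by (metis antisym subsetI)
    then show "B = C"
      by (simp add: set_of_compacts_inject)
  next
    assume "B = C"
    then show "dist B C = 0"
      by (simp add: dist_compacts_def hausdorff_dist_def set_of_compacts_nonempty)
  qed
  show "dist B C \<le> dist B D + dist C D" for B C D :: "'a compacts"
  proof -
    have *: "infdist x (set_of_compacts Z) \<le> dist X Y + dist Y Z"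
      if "x \<in> set_of_compacts X" for x and X Y Z :: "'a compacts"
    proof -
      have "infdist x (set_of_compacts Z) \<le> infdist x (set_of_compacts Y) + dist Y Z"
        using le[of Y Z "dist Y Z"]
        by (intro infdist_le_infdist_add set_of_compacts_nonempty) auto
      moreover have "infdist x (set_of_compacts Y) \<le> dist X Y"
        using le[of X Y "dist X Y"] that by auto
      ultimately show ?thesis by simp
    qed
    have sym: "dist X Y = dist Y X" for X Y :: "'a compacts"
      by (simp add: dist_compacts_def hausdorff_dist_def max.commute)
    show ?thesis
      unfolding le using *[of _ B C D] *[of _ C B D] by (metis * sym add.commute)
  qed
qed (simp_all add: uniformity_compacts_def open_compacts_def)

end

definition compacts_in :: "'a::metric_space set \<Rightarrow> 'a compacts set" where
  "compacts_in K = {B. set_of_compacts B \<subseteq> K}"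

text \<open>The induced map is meaningful for continuous \<open>f\<close> only: then the image of a
  nonempty compact set is again nonempty and compact.\<close>

definition induced_map ::
    "('a::metric_space \<Rightarrow> 'b::metric_space) \<Rightarrow> 'a compacts \<Rightarrow> 'b compacts" where
  "induced_map f B = Compacts (f ` set_of_compacts B)"

lemma set_of_compacts_induced_map:
  assumes "continuous_on UNIV f"
  shows "set_of_compacts (induced_map f B) = f ` set_of_compacts B"
  unfolding induced_map_def
  using compact_continuous_image[OF continuous_on_subset[OF assms] compact_set_of_compacts]
  by (subst Compacts_inverse) (auto simp: set_of_compacts_nonempty)

text \<open>Matrices are functions on indices \<open>{1..N}\<close>; values outside this range are irrelevant.\<close>

definition transition_matrix :: "nat \<Rightarrow> (nat \<Rightarrow> nat \<Rightarrow> nat) \<Rightarrow> bool" where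
  "transition_matrix N A \<longleftrightarrow>
     N \<ge> 2 \<and>
     (\<forall>i\<in>{1..N}. \<forall>j\<in>{1..N}. A i j \<in> {0, 1}) \<and>
     (\<forall>i\<in>{1..N}. (\<Sum>j=1..N. A i j) \<ge> 1) \<and>
     (\<forall>j\<in>{1..N}. (\<Sum>i=1..N. A i j) \<ge> 1)"

text \<open>In the following definitions the phase space is the whole type, and \<open>W i n\<close> is the
  \<open>n\<close>-th member of the \<open>i\<close>-th sequence of sets.\<close>

definition weakly_coupled_expanding ::
    "nat \<Rightarrow> (nat \<Rightarrow> nat \<Rightarrow> nat) \<Rightarrow> (nat \<Rightarrow> 'z::metric_space \<Rightarrow> 'z) \<Rightarrow>
     (nat \<Rightarrow> nat \<Rightarrow> 'z set) \<Rightarrow> bool" where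
  "weakly_coupled_expanding N A g W \<longleftrightarrow>
     (\<forall>i\<in>{1..N}. \<forall>n. W i n \<noteq> {}) \<and>
     (\<forall>i\<in>{1..N}. \<forall>j\<in>{1..N}. \<forall>n. i \<noteq> j \<longrightarrow>
        W i n \<inter> W j n = frontier (W i n) \<inter> frontier (W j n)) \<and>
     (\<forall>i\<in>{1..N}. \<forall>n. (\<Union>j\<in>{j\<in>{1..N}. A i j = 1}. W j (Suc n)) \<subseteq> g n ` W i n)"

definition strictly_weakly_coupled_expanding ::
    "nat \<Rightarrow> (nat \<Rightarrow> nat \<Rightarrow> nat) \<Rightarrow> (nat \<Rightarrow> 'z::metric_space \<Rightarrow> 'z) \<Rightarrow>
     (nat \<Rightarrow> nat \<Rightarrow> 'z set) \<Rightarrow> bool" where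
  "strictly_weakly_coupled_expanding N A g W \<longleftrightarrow>
     (\<forall>i\<in>{1..N}. \<forall>n. W i n \<noteq> {}) \<and>
     (\<forall>i\<in>{1..N}. \<forall>j\<in>{1..N}. \<forall>n. i \<noteq> j \<longrightarrow> setdist (W i n) (W j n) > 0) \<and>
     (\<forall>i\<in>{1..N}. \<forall>n. (\<Union>j\<in>{j\<in>{1..N}. A i j = 1}. W j (Suc n)) \<subseteq> g n ` W i n)"

end

theory Submission
  imports Defs
begin

text \<open>Singletons embed \<open>X\<close> isometrically in \<open>\<K>(X)\<close> and carry the conditions on \<open>\<K>(X)\<close> back to
  \<open>X\<close>.  For the boundary condition the point is that taking interiors commutes with
  \<open>\<langle>\<cdot>\<rangle>\<close>, so that for closed \<open>V\<close> a compact \<open>B \<subseteq> V\<close> lies on the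
  boundary of \<open>\<langle>V\<rangle>\<close> iff \<open>B\<close> meets the boundary of \<open>V\<close>.  A compact set in
  \<open>f(V)\<close> is the image of the compact set \<open>V \<inter> f\<^sup>-\<^sup>1(B)\<close>.\<close>

lemma set_of_compacts_Compacts:
  "compact B \<Longrightarrow> B \<noteq> {} \<Longrightarrow> set_of_compacts (Compacts B) = B"
  by (simp add: Compacts_inverse)

lemma dist_compacts_le_iff:
  "dist B C \<le> r \<longleftrightarrow>
    (\<forall>b\<in>set_of_compacts B. infdist b (set_of_compacts C) \<le> r) \<and>
    (\<forall>c\<in>set_of_compacts C. infdist c (set_of_compacts B) \<le> r)"
  unfolding dist_compacts_def
  by (intro hausdorff_dist_le_iff compact_set_of_compacts set_of_compacts_nonempty)

text \<open>Compactness of \<open>C\<close> makes the distance from \<open>b\<close> to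
  \<open>C\<close> attained, so the bound holds for an actual point \<open>c\<close> and without any
  slack. This turns closeness of sets into closeness of points.\<close>

lemma infdist_attained_le_dist_compacts:
  assumes "b \<in> set_of_compacts B"
  obtains c where "c \<in> set_of_compacts C" "dist b c \<le> dist B C"
proof -
  obtain c where c: "c \<in> set_of_compacts C" "\<forall>y\<in>set_of_compacts C. dist b c \<le> dist b y"
    using continuous_attains_inf[OF compact_set_of_compacts set_of_compacts_nonempty, of C "dist b"]
      continuous_on_dist[OF continuous_on_const continuous_on_id] by blast
  then have "dist b c \<le> infdist b (set_of_compacts C)"
    by (auto simp: infdist_notempty set_of_compacts_nonempty intro: cINF_greatest)
  also have "\<dots> \<le> dist B C"
    using dist_compacts_le_iff[of B C "dist B C"] assms by simp
  finally show thesis using c that by blast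
qed

lemma dist_Compacts_singletons: "dist (Compacts {x}) (Compacts {y}) = dist x y"
  by (simp add: dist_compacts_def hausdorff_dist_def set_of_compacts_Compacts dist_commute)

lemma Compacts_singleton_in_compacts_in_iff [simp]: "Compacts {x} \<in> compacts_in K \<longleftrightarrow> x \<in> K"
  by (simp add: compacts_in_def set_of_compacts_Compacts)

lemma compacts_in_eq_empty_iff [simp]: "compacts_in K = {} \<longleftrightarrow> K = {}"
proof
  show "K = {}" if "compacts_in K = {}"
    using that Compacts_singleton_in_compacts_in_iff by blast
qed (auto simp: compacts_in_def set_of_compacts_nonempty)

lemma compacts_in_mono: "K \<subseteq> L \<Longrightarrow> compacts_in K \<subseteq> compacts_in L"
  by (auto simp: compacts_in_def)

text \<open>Compactness supplies one radius \<open>e\<close> that works at all points of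
  \<open>B\<close>. Every \<open>C\<close> within \<open>e\<close> of \<open>B\<close> stays in the
  \<open>e\<close>-neighbourhood of \<open>B\<close>, hence in \<open>U\<close>.\<close>

lemma open_compacts_in:
  assumes "open U"
  shows "open (compacts_in U)"
  unfolding open_dist
proof
  fix B assume "B \<in> compacts_in U"
  then obtain e where "e > 0" and e: "(\<Union>x\<in>set_of_compacts B. ball x e) \<subseteq> U"
    using compact_subset_open_imp_ball_epsilon_subset[OF compact_set_of_compacts assms]
    by (auto simp: compacts_in_def)
  have "C \<in> compacts_in U" if "dist C B < e" for C
    unfolding compacts_in_def
  proof (intro CollectI subsetI)
    fix c assume "c \<in> set_of_compacts C"
    then obtain b where "b \<in> set_of_compacts B" "dist c b \<le> dist C B"
      by (rule infdist_attained_le_dist_compacts)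
    then show "c \<in> U" using that e by (force simp: dist_commute)
  qed
  then show "\<exists>e>0. \<forall>C. dist C B < e \<longrightarrow> C \<in> compacts_in U"
    using \<open>e > 0\<close> by blast
qed

text \<open>A single point \<open>b\<close> of \<open>B\<close> outside \<open>K\<close> is a stable
  obstruction: every \<open>C\<close> near \<open>B\<close> has a point near \<open>b\<close>, and
  that point is still outside \<open>K\<close>.\<close>

lemma closed_compacts_in:
  assumes "closed K"
  shows "closed (compacts_in K)"
  unfolding closed_def open_dist
proof
  fix B assume "B \<in> - compacts_in K"
  then obtain b where b: "b \<in> set_of_compacts B" "b \<in> - K" by (auto simp: compacts_in_def)
  then obtain e where "e > 0" and e: "\<And>c. dist c b < e \<Longrightarrow> c \<in> - K"
    using assms unfolding closed_def open_dist by blast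
  have "C \<notin> compacts_in K" if "dist C B < e" for C
  proof -
    obtain c where "c \<in> set_of_compacts C" "dist b c \<le> dist B C"
      using b by (meson infdist_attained_le_dist_compacts)
    then show ?thesis using that e[of c] by (auto simp: dist_commute compacts_in_def)
  qed
  then show "\<exists>e>0. \<forall>C. dist C B < e \<longrightarrow> C \<in> - compacts_in K"
    using \<open>e > 0\<close> by blast
qed

text \<open>Only the added point \<open>c\<close> can be away from the other set, and
  \<open>b\<close> bounds its distance. The lemma supplies the perturbations of \<open>B\<close>
  that detect interior points.\<close>

lemma dist_Compacts_insert_le:
  assumes "b \<in> set_of_compacts B"
  shows "dist (Compacts (insert c (set_of_compacts B))) B \<le> dist c b"
  unfolding dist_compacts_le_iff
  using assms infdist_le[OF assms, of c]
  by (auto simp: set_of_compacts_Compacts compact_insert compact_set_of_compacts)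

lemma interior_compacts_in: "interior (compacts_in K) = compacts_in (interior K)"
proof
  show "compacts_in (interior K) \<subseteq> interior (compacts_in K)"
    by (intro interior_maximal compacts_in_mono interior_subset open_compacts_in open_interior)
  show "interior (compacts_in K) \<subseteq> compacts_in (interior K)"
  proof
    fix B assume "B \<in> interior (compacts_in K)"
    then obtain e where "e > 0" and e: "ball B e \<subseteq> compacts_in K"
      by (auto simp: mem_interior)
    \<comment> \<open>Adding to \<open>B\<close> a point \<open>c\<close> of this ball moves
      \<open>B\<close> by less than \<open>e\<close>, so the enlarged set is still contained in
      \<open>K\<close>, and \<open>c\<close> with it.\<close>
    have "ball b e \<subseteq> K" if b: "b \<in> set_of_compacts B" for b
    proof
      fix c assume "c \<in> ball b e"
      then have "Compacts (insert c (set_of_compacts B)) \<in> ball B e"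
        using dist_Compacts_insert_le[OF b, of c] by (simp add: dist_commute)
      then show "c \<in> K"
        using e by (auto simp: compacts_in_def set_of_compacts_Compacts compact_insert
            compact_set_of_compacts)
    qed
    then show "B \<in> compacts_in (interior K)"
      using \<open>e > 0\<close> unfolding compacts_in_def by (blast intro: mem_interior[THEN iffD2])
  qed
qed

lemma frontier_compacts_in:
  "closed K \<Longrightarrow> frontier (compacts_in K) = compacts_in K - compacts_in (interior K)"
  by (simp add: frontier_def closed_compacts_in interior_compacts_in)

text \<open>For closed sets, both conditions say that no element of the intersection is interior to
  either set. Singletons carry this down to points; conversely, one point of a nonempty
  \<open>B\<close> prevents \<open>B\<close> from lying in an interior.\<close>

lemma Int_eq_frontier_Int_compacts_in_iff:
  assumes "closed V" "closed W"
  shows "compacts_in V \<inter> compacts_in W = frontier (compacts_in V) \<inter> frontier (compacts_in W)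
    \<longleftrightarrow> V \<inter> W = frontier V \<inter> frontier W" (is "?L \<longleftrightarrow> ?R")
proof
  assume L: ?L
  have "x \<notin> interior V" "x \<notin> interior W" if "x \<in> V \<inter> W" for x
  proof -
    have "Compacts {x} \<in> compacts_in V \<inter> compacts_in W" using that by simp
    with L have "Compacts {x} \<in> frontier (compacts_in V) \<inter> frontier (compacts_in W)"
      by (simp only:)
    then show "x \<notin> interior V" "x \<notin> interior W"
      using assms by (simp_all add: frontier_compacts_in)
  qed
  then show ?R using assms by (auto simp: frontier_def)
next
  assume R: ?R
  have disj: "V \<inter> W \<inter> interior V = {}" "V \<inter> W \<inter> interior W = {}"
    using R by (auto simp: frontier_def)
  have "B \<notin> compacts_in (interior V)" "B \<notin> compacts_in (interior W)"
    if "B \<in> compacts_in V \<inter> compacts_in W" for B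
    using that disj set_of_compacts_nonempty[of B] by (auto simp: compacts_in_def)
  then show ?L using assms by (auto simp: frontier_compacts_in)
qed

lemma setdist_compacts_in:
  "setdist (compacts_in V) (compacts_in W) = setdist V W"
proof (cases "V = {} \<or> W = {}")
  \<comment> \<open>Here both sides are 0, the value of \<open>setdist\<close> when an argument is
    empty.\<close>
  case True
  then show ?thesis
    by (metis compacts_in_eq_empty_iff setdist_empty1 setdist_empty2)
next
  case False
  show ?thesis
  proof (rule antisym)
    show "setdist (compacts_in V) (compacts_in W) \<le> setdist V W"
    proof (rule le_setdistI)
      fix x y assume "x \<in> V" "y \<in> W"
      then show "setdist (compacts_in V) (compacts_in W) \<le> dist x y"
        unfolding dist_Compacts_singletons[of x y, symmetric] by (intro setdist_le_dist) simp_all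
    qed (use False in auto)
    show "setdist V W \<le> setdist (compacts_in V) (compacts_in W)"
    proof (rule le_setdistI)
      fix B C assume BC: "B \<in> compacts_in V" "C \<in> compacts_in W"
      \<comment> \<open>Any point of \<open>B\<close> serves: its nearest point in \<open>C\<close>
        is at most \<open>dist B C\<close> away.\<close>
      obtain b where b: "b \<in> set_of_compacts B" using set_of_compacts_nonempty by blast
      then obtain c where "c \<in> set_of_compacts C" "dist b c \<le> dist B C"
        by (rule infdist_attained_le_dist_compacts)
      moreover have "setdist V W \<le> dist b c"
        using BC b calculation(1) by (intro setdist_le_dist) (auto simp: compacts_in_def)
      ultimately show "setdist V W \<le> dist B C" by simp
    qed (use False in auto)
  qed
qed

lemma compacts_in_subset_induced_map_image_iff:
  fixes f :: "'a::metric_space \<Rightarrow> 'b::metric_space"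
  assumes f: "continuous_on UNIV f" and V: "compact V"
  shows "compacts_in W \<subseteq> induced_map f ` compacts_in V \<longleftrightarrow> W \<subseteq> f ` V" (is "?L \<longleftrightarrow> ?R")
proof
  assume L: ?L
  show ?R
  proof
    fix y assume "y \<in> W"
    then obtain C where C: "C \<in> compacts_in V" "Compacts {y} = induced_map f C"
      using L Compacts_singleton_in_compacts_in_iff by blast
    \<comment> \<open>Every point of the nonempty set \<open>C\<close> is sent to \<open>y\<close>,
      so any of them is a preimage of \<open>y\<close> in \<open>V\<close>.\<close>
    then have "f ` set_of_compacts C = {y}"
      by (metis set_of_compacts_induced_map[OF f] set_of_compacts_Compacts compact_sing
          insert_not_empty)
    then show "y \<in> f ` V" using C by (auto simp: compacts_in_def)
  qed
next
  assume R: ?R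
  show ?L
  proof
    fix B assume "B \<in> compacts_in W"
    then have BV: "set_of_compacts B \<subseteq> f ` V" using R by (auto simp: compacts_in_def)
    \<comment> \<open>This is the largest subset of \<open>V\<close> mapped into \<open>B\<close>.
      By continuity it is closed in the compact \<open>V\<close>, and \<open>BV\<close> makes its
      image all of \<open>B\<close>.\<close>
    define C where "C = V \<inter> f -` set_of_compacts B"
    have "compact C"
      unfolding C_def
      by (intro compact_Int_closed V closed_vimage f compact_imp_closed compact_set_of_compacts)
    moreover have fC: "f ` C = set_of_compacts B" using BV by (auto simp: C_def)
    moreover from fC have "C \<noteq> {}" using set_of_compacts_nonempty[of B] by auto
    ultimately have "set_of_compacts (Compacts C) = C" by (simp add: set_of_compacts_Compacts)
    then have "Compacts C \<in> compacts_in V" and "induced_map f (Compacts C) = B"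
      by (auto simp: compacts_in_def C_def induced_map_def fC[unfolded C_def]
          set_of_compacts_inverse)
    then show "B \<in> induced_map f ` compacts_in V" by blast
  qed
qed

theorem proposition4p4:
  fixes f :: "nat \<Rightarrow> 'a::metric_space \<Rightarrow> 'a"
    and N :: nat
    and A :: "nat \<Rightarrow> nat \<Rightarrow> nat"
    and V :: "nat \<Rightarrow> nat \<Rightarrow> 'a set"
  assumes "compact (UNIV :: 'a set)"
    and "\<And>n. continuous_on UNIV (f n)"
    and "transition_matrix N A"
    and "\<And>i n. i \<in> {1..N} \<Longrightarrow> V i n \<noteq> {}"
    and "\<And>i n. i \<in> {1..N} \<Longrightarrow> closed (V i n)"
  shows "(weakly_coupled_expanding N A f V \<longleftrightarrow>
          weakly_coupled_expanding N A (\<lambda>n. induced_map (f n)) (\<lambda>i n. compacts_in (V i n))) \<and>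
         (strictly_weakly_coupled_expanding N A f V \<longleftrightarrow>
          strictly_weakly_coupled_expanding N A (\<lambda>n. induced_map (f n)) (\<lambda>i n. compacts_in (V i n)))"
proof -
  have "compact (V i n)" if "i \<in> {1..N}" for i n
    using compact_Int_closed[OF assms(1) assms(5)[OF that, of n]] by simp
  then have covering: "(\<forall>i\<in>{1..N}. \<forall>n. (\<Union>j\<in>{j\<in>{1..N}. A i j = 1}. V j (Suc n)) \<subseteq> f n ` V i n) \<longleftrightarrow>
      (\<forall>i\<in>{1..N}. \<forall>n. (\<Union>j\<in>{j\<in>{1..N}. A i j = 1}. compacts_in (V j (Suc n)))
        \<subseteq> induced_map (f n) ` compacts_in (V i n))"
    \<comment> \<open>The inclusion is split over \<open>j\<close> before passing to
      \<open>compacts_in\<close>: a compact subset of a union need not lie in one of its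
      members.\<close>
    unfolding UN_subset_iff
    by (intro ball_cong all_cong refl)
      (simp add: compacts_in_subset_induced_map_image_iff[OF assms(2)])
  have boundary: "(\<forall>i\<in>{1..N}. \<forall>j\<in>{1..N}. \<forall>n. i \<noteq> j \<longrightarrow>
        V i n \<inter> V j n = frontier (V i n) \<inter> frontier (V j n)) \<longleftrightarrow>
      (\<forall>i\<in>{1..N}. \<forall>j\<in>{1..N}. \<forall>n. i \<noteq> j \<longrightarrow>
        compacts_in (V i n) \<inter> compacts_in (V j n) =
        frontier (compacts_in (V i n)) \<inter> frontier (compacts_in (V j n)))"
    by (simp add: Int_eq_frontier_Int_compacts_in_iff assms(5))
  show ?thesis
    unfolding weakly_coupled_expanding_def strictly_weakly_coupled_expanding_def covering boundary
    by (simp add: setdist_compacts_in)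
qed

end
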